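(* Consider a random dynamical system $S(\omega,x)=(\theta\omega,T_\omega x)$ on $\Omega\times X$ preserving $\nu=\mathbb{P}\otimes\mu_\omega$. Assume that the compact metric space $X$ has bounded local complexity. Then, for $\mathbb{P}$-almost every $\omega$, for $\mu_\omega^{\otimes2}$-almost every $(x,y)$, $$\limsup_{n\to\infty}\frac{-\log m_n^{\le}(\omega;x,y)}{\log n}\le\frac{1}{\underline{D}_2^{\mathrm{qu}}},$$ where $m_n^{\le}(\omega;x,y)=\min\{d(T_\omega^ix,T_\omega^jy): 0\le i,j<n,\ |j-i|\le\alpha(n)\}$.
   Context: Random dynamical system: $\Omega$ is a compact metric space with a probability measure $\mathbb{P}$, and $\theta:\Omega\to\Omega$ is invertible and preserves $\mathbb{P}$. $(X,d)$ is a metric space and, for each $\omega\in\Omega$, $T_\omega:X\to X$ is measurable, such that the skew product $S(\omega,x)=(\theta\omega,T_\omega x)$ is measurable and preserves a probability measure $\nu$ on $\Omega\times X$ whose marginal on $\Omega$ is $\mathbb{P}$. Write $T_\omega^n=T_{\theta^{n-1}\omega}\circ\dots\circ T_\omega$. The measure $\nu$ is disintegrated above $\mathbb{P}$ into probability measures $\mu_\omega$ on $X$ depending measurably on $\omega$: $\int f\,d\nu=\int(\int f(\omega,x)\,d\mu_\omega(x))\,d\mathbb{P}(\omega)$, written $\nu=\mathbb{P}\otimes\mu_\omega$; one has $(T_\omega)_*\mu_\omega=\mu_{\theta\omega}$ for $\mathbb{P}$-a.e. $\omega$. Bounded local complexity: a compact metric space $X$ has bounded local complexity if there is a constant $C_0$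 such that, for every small enough $r>0$, there are $k(r)<\infty$ and points $x^{(r)}_1,\dots,x^{(r)}_{k(r)}\in X$ such that the balls $B(x^{(r)}_p,r)$, $1\le p\le k(r)$, cover $X$ and any point of $X$ belongs to at most $C_0$ of the balls $B(x^{(r)}_p,4r)$. Lower quenched correlation dimension: $$\underline{D}_2^{\mathrm{qu}}=\liminf_{r\to0}\frac{\log\int\int\mu_\omega(B(x,r))\,d\mu_\omega(x)\,d\mathbb{P}(\omega)}{\log r}.$$ Gap function: $\alpha(n)=(\log n)^{C_4}$, where $C_4>0$ is a fixed constant. Conventions: $-\log0=+\infty$ and $1/0=+\infty$. *)

theory Defs
  imports "HOL-Probability.Probability"
begin

(* Both spaces are types: Omega = 'w and X = 'x, with balls and distances from metric_space.
   sigma-algebras are the Borel ones; on Omega x X we use the product sigma-algebra.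
   Compactness of X is not part of the locale. *)
locale random_dynamical_system =
  fixes P :: "'w::metric_space measure"
    and \<theta> :: "'w \<Rightarrow> 'w"
    and T :: "'w \<Rightarrow> 'x::metric_space \<Rightarrow> 'x"
    and \<nu> :: "('w \<times> 'x) measure"
    and \<mu> :: "'w \<Rightarrow> 'x measure"
  assumes compact_base: "compact (UNIV :: 'w set)"
    and prob_P: "prob_space P"
    and sets_P: "sets P = sets borel"
    (* "invertible" is meant in the measurable category *)
    and bij_theta: "bij \<theta>"
    and measurable_theta: "\<theta> \<in> P \<rightarrow>\<^sub>M P"
    and measurable_inv_theta: "inv \<theta> \<in> P \<rightarrow>\<^sub>M P"
    and preserves_P: "distr P P \<theta> = P"
    and measurable_T: "\<And>\<omega>. T \<omega> \<in> borel \<rightarrow>\<^sub>M borel"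
    and measurable_skew:
      "(\<lambda>(\<omega>, x). (\<theta> \<omega>, T \<omega> x)) \<in> P \<Otimes>\<^sub>M borel \<rightarrow>\<^sub>M P \<Otimes>\<^sub>M borel"
    and prob_nu: "prob_space \<nu>"
    and sets_nu: "sets \<nu> = sets (P \<Otimes>\<^sub>M borel)"
    and preserves_nu: "distr \<nu> \<nu> (\<lambda>(\<omega>, x). (\<theta> \<omega>, T \<omega> x)) = \<nu>"
    and marginal_nu: "distr \<nu> P fst = P"
    and measurable_mu: "\<mu> \<in> P \<rightarrow>\<^sub>M prob_algebra borel"
    and disintegration:
      "\<And>f :: 'w \<times> 'x \<Rightarrow> ennreal. f \<in> borel_measurable (P \<Otimes>\<^sub>M borel) \<Longrightarrow>
         (\<integral>\<^sup>+z. f z \<partial>\<nu>) = (\<integral>\<^sup>+\<omega>. (\<integral>\<^sup>+x. f (\<omega>, x) \<partial>\<mu> \<omega>) \<partial>P)"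

primrec rds_iter :: "('w \<Rightarrow> 'w) \<Rightarrow> ('w \<Rightarrow> 'x \<Rightarrow> 'x) \<Rightarrow> nat \<Rightarrow> 'w \<Rightarrow> 'x \<Rightarrow> 'x" where
  "rds_iter \<theta> T 0 \<omega> = id"
| "rds_iter \<theta> T (Suc n) \<omega> = T ((\<theta> ^^ n) \<omega>) \<circ> rds_iter \<theta> T n \<omega>"

(* Multiplicity is counted by indices, so repeated centres count repeatedly. *)
definition bounded_local_complexity :: "'x::metric_space set \<Rightarrow> bool" where
  "bounded_local_complexity X \<longleftrightarrow>
     (\<exists>C\<^sub>0::nat. \<exists>r\<^sub>0>0. \<forall>r::real. 0 < r \<and> r < r\<^sub>0 \<longrightarrow>
        (\<exists>(k::nat) c. c ` {1..k} \<subseteq> X \<and> X \<subseteq> (\<Union>p\<in>{1..k}. ball (c p) r) \<and>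
           (\<forall>x\<in>X. card {p \<in> {1..k}. x \<in> ball (c p) (4 * r)} \<le> C\<^sub>0)))"

(* Logarithm on [0, oo) with values in [-oo, oo), so that - elog 0 = oo. *)
definition elog :: "real \<Rightarrow> ereal" where
  "elog t = (if t = 0 then -\<infinity> else ereal (ln t))"

definition lower_quenched_corr_dim :: "'w measure \<Rightarrow> ('w \<Rightarrow> 'x::metric_space measure) \<Rightarrow> ereal" where
  "lower_quenched_corr_dim P \<mu> =
     Liminf (at_right 0) (\<lambda>r::real.
       elog (\<integral>\<omega>. (\<integral>x. measure (\<mu> \<omega>) (ball x r) \<partial>\<mu> \<omega>) \<partial>P) / elog r)"

definition gap :: "real \<Rightarrow> nat \<Rightarrow> real" where
  "gap C\<^sub>4 n = ln (real n) powr C\<^sub>4"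

(* The minimum is over a nonempty set only for n > 0. *)
definition min_dist_le ::
  "('w \<Rightarrow> 'w) \<Rightarrow> ('w \<Rightarrow> 'x::metric_space \<Rightarrow> 'x) \<Rightarrow> (nat \<Rightarrow> real) \<Rightarrow> nat \<Rightarrow> 'w \<Rightarrow> 'x \<Rightarrow> 'x \<Rightarrow> real" where
  "min_dist_le \<theta> T \<alpha> n \<omega> x y =
     Min {dist (rds_iter \<theta> T i \<omega> x) (rds_iter \<theta> T j \<omega> y) | i j.
            i < n \<and> j < n \<and> \<bar>real j - real i\<bar> \<le> \<alpha> n}"

end

theory Submission
  imports Defs "HOL-Real_Asymp.Real_Asymp"
begin

text \<open>
  The proof is a first moment computation followed by the Borel--Cantelli lemma. Write \<open>I(r)\<close>
  (\<open>quenched_corr\<close>) for the averaged correlation integral whose decay rate defines the lower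
  quenched correlation dimension \<open>D\<close>. If \<open>D = 0\<close> the bound is
  \<open>\<infinity>\<close>, so let \<open>0 < s < D\<close>; then \<open>I(r) \<le> r\<^sup>s\<close> for
  small \<open>r\<close>.

  For fixed times \<open>i, j\<close>, the expected probability that \<open>T\<^sup>i x\<close> and
  \<open>T\<^sup>j y\<close> are \<open>r\<close>-close is at most a constant times \<open>I(4r)\<close>
  (\<open>nn_integral_near_le\<close>). Indeed, cover the space by balls of radius \<open>r\<close> and
  bounded multiplicity: closeness forces both points into a common ball \<open>B\<close> of the doubled
  radius. On the fibre over \<open>\<omega>\<close> the points are independent, and \<open>T\<^sup>i x\<close>
  falls into \<open>B\<close> with probability \<open>\<mu>(B)\<close>, where \<open>\<mu>\<close> is the
  fibre measure over \<open>\<theta>\<^sup>i \<omega>\<close>. The two fibres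
  \<open>\<theta>\<^sup>i\<omega>\<close> and \<open>\<theta>\<^sup>j\<omega>\<close> are different, but
  \<open>2ab \<le> a\<^sup>2 + b\<^sup>2\<close> decouples them, and since \<open>\<theta>\<close> preserves
  the base measure both squares have the integral \<open>\<integral>\<mu>\<^sub>\<omega>(B)\<^sup>2 dP\<close>
  (\<open>nn_integral_mu_preimage_mult_le\<close>). Summing over the balls, \<open>\<Sum>\<mu>(B)\<^sup>2
  \<le> C\<^sub>0 \<integral>\<mu>(ball x (4r)) d\<mu>(x)\<close>
  (\<open>sum_squares_ball_le_correlation\<close>).

  At time \<open>n\<close> there are only about \<open>n (log n)\<^sup>c\<close> admissible pairs \<open>(i,
  j)\<close>, so for \<open>r = n powr (- a)\<close> the expected probability of an encounter at distance
  \<open>r\<close> is at most of order \<open>(log n)\<^sup>c n powr (1 - as)\<close>. If \<open>as >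
  1\<close> this is summable along \<open>n = 2\<^sup>k\<close>, and almost surely there is no such encounter
  for large \<open>k\<close>. As the minimal distance decreases with \<open>n\<close>, its behaviour along
  \<open>2\<^sup>k\<close> controls the whole sequence and the upper limit is at most \<open>a\<close>.
  Rational \<open>a\<close> decreasing to \<open>1 / D\<close> give the claim.
\<close>

section \<open>Measure-theoretic preliminaries\<close>

text \<open>
  The Borel sets of a product of metric spaces can exceed the product \<open>\<sigma>\<close>-algebra.
  Total boundedness rescues measurability of the distance: the set is a countable union of
  rectangles of balls.
\<close>

lemma sets_dist_less:
  assumes "compact (UNIV :: 'x::metric_space set)"
  shows "{(x, y). dist x y < r} \<in> sets (borel \<Otimes>\<^sub>M (borel :: 'x measure))"
proof -
  have "\<forall>n. \<exists>F :: 'x set. finite F \<and> UNIV \<subseteq> (\<Union>c\<in>F. ball c (1 / real (Suc n)))"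
    using assms unfolding compact_eq_totally_bounded by simp
  from choice[OF this] obtain F :: "nat \<Rightarrow> 'x set" where fin: "\<And>n. finite (F n)"
    and cover: "\<And>n. UNIV \<subseteq> (\<Union>c\<in>F n. ball c (1 / real (Suc n)))"
    by blast
  have "{(x, y). dist x y < r} =
      (\<Union>n. \<Union>c\<in>F n. ball c (1 / real (Suc n)) \<times> ball c (r - 1 / real (Suc n)))" (is "_ = ?U")
  proof (intro equalityI subsetI; clarsimp simp del: of_nat_Suc)
    fix x y :: 'x assume "dist x y < r"
    then obtain n where n: "1 / real (Suc n) < (r - dist x y) / 2"
      using nat_approx_posE[of "(r - dist x y) / 2"] by auto
    obtain c where c: "c \<in> F n" "dist c x < 1 / real (Suc n)"
      using subsetD[OF cover[of n] UNIV_I[of x]] by (auto simp del: of_nat_Suc)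
    have "dist c y < r - e" if "dist c x < e" "e < (r - dist x y) / 2" for e
      using dist_triangle[of c y x] that by (simp add: field_simps)
    from this[OF c(2) n] have "dist c y < r - 1 / real (Suc n)" .
    with c show "\<exists>n. \<exists>c\<in>F n. dist c x < 1 / real (Suc n) \<and> dist c y < r - 1 / real (Suc n)"
      by blast
  next
    fix n c and x y :: 'x
    assume "dist c x < 1 / real (Suc n)" "dist c y < r - 1 / real (Suc n)"
    then show "dist x y < r"
      using dist_triangle3[of x y c] by linarith
  qed
  also have "?U \<in> sets (borel \<Otimes>\<^sub>M borel)"
    using fin by (intro sets.countable_UN' sets.finite_UN pair_measureI borel_open) auto
  finally show ?thesis .
qed

text \<open>
  A quenched Borel--Cantelli lemma: by Tonelli the expected sum of the fibre probabilities is
  finite, hence the sum is finite on almost every fibre, where the classical lemma applies.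
\<close>
lemma kernel_borel_cantelli:
  assumes K: "K \<in> P \<rightarrow>\<^sub>M subprob_algebra N"
    and E: "\<And>k. (SIGMA \<omega>:space P. E k \<omega>) \<in> sets (P \<Otimes>\<^sub>M N)"
    and fin: "(\<Sum>k. \<integral>\<^sup>+\<omega>. emeasure (K \<omega>) (E k \<omega>) \<partial>P) \<noteq> top"
  shows "AE \<omega> in P. AE z in K \<omega>. eventually (\<lambda>k::nat. z \<notin> E k \<omega>) sequentially"
proof -
  have meas[measurable]: "(\<lambda>\<omega>. emeasure (K \<omega>) (E k \<omega>)) \<in> borel_measurable P" for k
    by (rule emeasure_measurable_subprob_algebra2[OF E K])
  have "(\<integral>\<^sup>+\<omega>. (\<Sum>k. emeasure (K \<omega>) (E k \<omega>)) \<partial>P) \<noteq> \<infinity>"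
    using fin by (subst nn_integral_suminf) (auto simp: infinity_ennreal_def)
  then have finite_sum: "AE \<omega> in P. (\<Sum>k. emeasure (K \<omega>) (E k \<omega>)) \<noteq> \<infinity>"
    by (intro nn_integral_noteq_infinite) auto
  show ?thesis
  proof (rule AE_mp[OF finite_sum], rule AE_I2, rule impI)
    fix \<omega> assume \<omega>: "\<omega> \<in> space P" and sum: "(\<Sum>k. emeasure (K \<omega>) (E k \<omega>)) \<noteq> \<infinity>"
    interpret subprob_space "K \<omega>"
      using measurable_space[OF K \<omega>] by (simp add: space_subprob_algebra)
    have sets: "sets (K \<omega>) = sets N"
      using measurable_space[OF K \<omega>] by (simp add: space_subprob_algebra)
    have Ek: "E k \<omega> \<in> sets (K \<omega>)" for k
    proof -
      have "Pair \<omega> -` (SIGMA \<omega>:space P. E k \<omega>) \<in> sets N"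
        by (rule sets_Pair1[OF E])
      moreover have "Pair \<omega> -` (SIGMA \<omega>:space P. E k \<omega>) = E k \<omega>"
        using \<omega> by auto
      ultimately show ?thesis by (simp add: sets)
    qed
    have "summable (\<lambda>k. measure (K \<omega>) (E k \<omega>))"
      using sum by (intro summable_suminf_not_top) (auto simp: emeasure_eq_measure)
    then have "AE z in K \<omega>. eventually (\<lambda>k. z \<in> space (K \<omega>) - E k \<omega>) sequentially"
      using Ek by (intro borel_cantelli_AE1) (auto simp: emeasure_eq_measure)
    then show "AE z in K \<omega>. eventually (\<lambda>k. z \<notin> E k \<omega>) sequentially"
      by (rule AE_mp) (auto elim: eventually_mono)
  qed
qed

text \<open>
  A ball of radius \<open>2r\<close> lies in the ball of radius \<open>4r\<close> around each of its points, so the square of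
  its mass is at most the integral over it of the mass of \<open>ball x (4r)\<close>. Bounded multiplicity lets
  these integrals be added.
\<close>
lemma sum_squares_ball_le_correlation:
  fixes M :: "'x::metric_space measure" and c :: "nat \<Rightarrow> 'x"
  assumes "prob_space M" and sets[measurable_cong]: "sets M = sets borel"
    and meas[measurable]: "(\<lambda>x. emeasure M (ball x (4 * r))) \<in> borel_measurable borel"
    and r: "0 < r"
    and mult: "\<And>x. card {p \<in> {1..k}. x \<in> ball (c p) (4 * r)} \<le> C"
  shows "(\<Sum>p\<in>{1..k}. (emeasure M (ball (c p) (2 * r)))\<^sup>2)
           \<le> of_nat C * (\<integral>\<^sup>+x. emeasure M (ball x (4 * r)) \<partial>M)"
proof -
  interpret prob_space M by fact
  let ?B = "\<lambda>p. ball (c p) (2 * r)"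
  have [measurable]: "?B p \<in> sets M" for p by (simp add: sets)
  have "(emeasure M (?B p))\<^sup>2 \<le> (\<integral>\<^sup>+x. emeasure M (ball x (4 * r)) * indicator (?B p) x \<partial>M)" for p
  proof -
    have "(emeasure M (?B p))\<^sup>2 = (\<integral>\<^sup>+x. emeasure M (?B p) * indicator (?B p) x \<partial>M)"
      by (simp add: power2_eq_square nn_integral_cmult)
    also have "\<dots> \<le> (\<integral>\<^sup>+x. emeasure M (ball x (4 * r)) * indicator (?B p) x \<partial>M)"
    proof (intro nn_integral_mono)
      fix x
      show "emeasure M (?B p) * indicator (?B p) x \<le> emeasure M (ball x (4 * r)) * indicator (?B p) x"
      proof (cases "x \<in> ?B p")
        case True
        have "?B p \<subseteq> ball x (4 * r)"
        proof
          fix y assume "y \<in> ?B p"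
          with True show "y \<in> ball x (4 * r)"
            using dist_triangle[of x y "c p"] by (simp add: dist_commute)
        qed
        with True show ?thesis by (auto intro!: emeasure_mono simp: sets)
      qed simp
    qed
    finally show ?thesis .
  qed
  then have "(\<Sum>p\<in>{1..k}. (emeasure M (?B p))\<^sup>2)
      \<le> (\<Sum>p\<in>{1..k}. \<integral>\<^sup>+x. emeasure M (ball x (4 * r)) * indicator (?B p) x \<partial>M)"
    by (intro sum_mono)
  also have "\<dots> = (\<integral>\<^sup>+x. (\<Sum>p\<in>{1..k}. emeasure M (ball x (4 * r)) * indicator (?B p) x) \<partial>M)"
    by (rule nn_integral_sum[symmetric]) measurable
  also have "\<dots> \<le> (\<integral>\<^sup>+x. of_nat C * emeasure M (ball x (4 * r)) \<partial>M)"
  proof (intro nn_integral_mono)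
    fix x
    have "(\<Sum>p\<in>{1..k}. indicator (?B p) x :: ennreal) = of_nat (card {p \<in> {1..k}. x \<in> ?B p})"
      by (simp add: indicator_def sum.If_cases Int_def)
    also have "card {p \<in> {1..k}. x \<in> ?B p} \<le> card {p \<in> {1..k}. x \<in> ball (c p) (4 * r)}"
      using r by (intro card_mono) auto
    then have "of_nat (card {p \<in> {1..k}. x \<in> ?B p}) \<le> (of_nat C :: ennreal)"
      using mult[of x] by (intro of_nat_mono) linarith
    finally have "emeasure M (ball x (4 * r)) * (\<Sum>p\<in>{1..k}. indicator (?B p) x)
        \<le> emeasure M (ball x (4 * r)) * of_nat C"
      by (rule mult_left_mono) simp
    then show "(\<Sum>p\<in>{1..k}. emeasure M (ball x (4 * r)) * indicator (?B p) x)
        \<le> of_nat C * emeasure M (ball x (4 * r))"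
      by (subst sum_distrib_left[symmetric]) (simp only: mult.commute)
  qed
  also have "\<dots> = of_nat C * (\<integral>\<^sup>+x. emeasure M (ball x (4 * r)) \<partial>M)"
    by (rule nn_integral_cmult) measurable
  finally show ?thesis .
qed

lemma two_mult_le_sum_squares_ennreal:
  fixes a b :: ennreal
  shows "2 * (a * b) \<le> a\<^sup>2 + b\<^sup>2"
proof -
  have *: "2 * (a * b) \<le> a\<^sup>2 + b\<^sup>2" if le: "a \<le> b" for a b :: ennreal
  proof -
    obtain c where b: "b = a + c" using le le_iff_add[of a b] by blast
    have "a\<^sup>2 + b\<^sup>2 = 2 * (a * b) + c\<^sup>2"
      unfolding b by (simp add: power2_eq_square algebra_simps mult_2 mult_2_right)
    then show ?thesis by (simp add: le_iff_add)
  qed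
  show ?thesis
    using *[of a b] *[of b a] by (cases "a \<le> b") (auto simp: mult.commute add.commute)
qed

section \<open>Pairs of times with bounded gap and dyadic sequences\<close>

definition gap_pairs :: "real \<Rightarrow> nat \<Rightarrow> (nat \<times> nat) set" where
  "gap_pairs a n = {(i, j). i < n \<and> j < n \<and> \<bar>real j - real i\<bar> \<le> a}"

lemma finite_gap_pairs[simp]: "finite (gap_pairs a n)"
  by (rule finite_subset[of _ "{..<n} \<times> {..<n}"]) (auto simp: gap_pairs_def)

lemma card_gap_pairs_le:
  assumes "0 \<le> a"
  shows "real (card (gap_pairs a n)) \<le> real n * (2 * a + 1)"
proof -
  define K where "K = nat \<lfloor>a\<rfloor>"
  have K: "real K \<le> a" using assms by (simp add: K_def)
  have "gap_pairs a n \<subseteq> (SIGMA i:{..<n}. {i - K..i + K})"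
  proof clarify
    fix i j assume ij: "(i, j) \<in> gap_pairs a n"
    then have "\<bar>int j - int i\<bar> \<le> \<lfloor>a\<rfloor>"
      by (simp add: gap_pairs_def le_floor_iff)
    then have "\<bar>int j - int i\<bar> \<le> int K"
      using assms by (simp add: K_def)
    then show "i \<in> {..<n} \<and> j \<in> {i - K..i + K}"
      using ij by (auto simp: gap_pairs_def)
  qed
  then have "card (gap_pairs a n) \<le> card (SIGMA i:{..<n}. {i - K..i + K})"
    by (intro card_mono) auto
  also have "\<dots> = (\<Sum>i<n. card {i - K..i + K})"
    by (simp add: card_SigmaI)
  also have "\<dots> \<le> (\<Sum>i<n. 2 * K + 1)"
    by (intro sum_mono) simp
  finally have "real (card (gap_pairs a n)) \<le> real (n * (2 * K + 1))"
    by (simp only: of_nat_le_iff) simp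
  also have "\<dots> = real n * (2 * real K + 1)"
    by (simp add: algebra_simps)
  also have "\<dots> \<le> real n * (2 * a + 1)"
    using K by (intro mult_left_mono) auto
  finally show ?thesis .
qed

lemma gap_mono:
  assumes "1 \<le> m" "m \<le> n" "0 < c"
  shows "gap c m \<le> gap c n"
  unfolding gap_def using assms by (intro powr_mono2) auto

lemma gap_nonneg: "0 \<le> gap c n"
  by (simp add: gap_def)

lemma min_dist_le_eq_Min_image:
  "min_dist_le \<theta> T \<alpha> n \<omega> x y =
     Min ((\<lambda>(i, j). dist (rds_iter \<theta> T i \<omega> x) (rds_iter \<theta> T j \<omega> y)) ` gap_pairs (\<alpha> n) n)"
  unfolding min_dist_le_def gap_pairs_def by (rule arg_cong[of _ _ Min]) auto

lemma zero_in_gap_pairs: "0 < n \<Longrightarrow> 0 \<le> a \<Longrightarrow> (0, 0) \<in> gap_pairs a n"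
  by (simp add: gap_pairs_def)

text \<open>
  Both the horizon and the admissible gap grow with \<open>n\<close>. Times start at 1
  because for \<open>n = 0\<close> there is no pair and the minimum is unspecified.
\<close>
lemma min_dist_le_antimono:
  assumes "1 \<le> m" "m \<le> n" "0 < c"
  shows "min_dist_le \<theta> T (gap c) n \<omega> x y \<le> min_dist_le \<theta> T (gap c) m \<omega> x y"
  unfolding min_dist_le_eq_Min_image
proof (rule Min_antimono)
  show "(\<lambda>(i, j). dist (rds_iter \<theta> T i \<omega> x) (rds_iter \<theta> T j \<omega> y)) ` gap_pairs (gap c m) m
      \<subseteq> (\<lambda>(i, j). dist (rds_iter \<theta> T i \<omega> x) (rds_iter \<theta> T j \<omega> y)) ` gap_pairs (gap c n) n"
    using gap_mono[OF assms] assms by (intro image_mono) (auto simp: gap_pairs_def)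
  show "(\<lambda>(i, j). dist (rds_iter \<theta> T i \<omega> x) (rds_iter \<theta> T j \<omega> y)) ` gap_pairs (gap c m) m \<noteq> {}"
    using zero_in_gap_pairs[of m "gap c m"] gap_nonneg[of c m] assms by auto
qed simp

text \<open>
  Passing from \<open>n\<close> to the next power of 2 changes \<open>ln n\<close> by at most \<open>ln 2\<close>, which is negligible
  on the logarithmic scale.
\<close>
lemma limsup_le_of_dyadic_lower_bound:
  fixes m :: "nat \<Rightarrow> real"
  assumes anti: "\<And>k n. 1 \<le> k \<Longrightarrow> k \<le> n \<Longrightarrow> m n \<le> m k"
    and bound: "\<forall>\<^sub>F k in sequentially. 2 powr (- (a * real k)) \<le> m (2 ^ k)"
    and a: "0 < a"
  shows "limsup (\<lambda>n. - elog (m n) / ereal (ln (real n))) \<le> ereal a"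
proof -
  obtain K where K: "\<And>k. K \<le> k \<Longrightarrow> 2 powr (- (a * real k)) \<le> m (2 ^ k)"
    using bound by (auto simp: eventually_sequentially)
  have "\<forall>\<^sub>F n in sequentially. - elog (m n) / ereal (ln (real n)) \<le> ereal (a * (ln n + ln 2) / ln n)"
    using eventually_ge_at_top[of "2 ^ K + 2"]
  proof eventually_elim
    fix n :: nat assume n: "2 ^ K + 2 \<le> n"
    obtain k where k: "2 ^ k \<le> n" "n < 2 ^ (k + 1)"
      using ex_power_ivl1[of 2 n] n by auto
    have "(2::nat) ^ K < 2 ^ (k + 1)" using n k by linarith
    then have "K < k + 1" by (rule power_less_imp_less_exp[rotated]) simp
    have lower: "2 powr (- (a * real (k + 1))) \<le> m n"
      using K[of "k + 1"] anti[of n "2 ^ (k + 1)"] \<open>K < k + 1\<close> k(2) n by linarith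
    moreover have pos: "0 < 2 powr (- (a * real (k + 1)))" by simp
    ultimately have m: "0 < m n" by linarith
    have "ln (2 powr (- (a * real (k + 1)))) \<le> ln (m n)"
      by (rule ln_mono) (use lower pos in auto)
    then have "- ln (m n) \<le> a * (real k * ln 2 + ln 2)"
      by (simp add: ln_powr algebra_simps)
    also have "real k * ln 2 = ln (2 ^ k)" by (simp add: ln_realpow)
    also have "\<dots> \<le> ln (real n)"
      using k(1) by (intro ln_mono) auto
    finally have "- ln (m n) \<le> a * (ln (real n) + ln 2)"
      using a by simp
    then have "- ln (m n) / ln (real n) \<le> a * (ln (real n) + ln 2) / ln (real n)"
      using n by (intro divide_right_mono) auto
    moreover have "0 < ln (real n)" using n by simp
    ultimately show "- elog (m n) / ereal (ln (real n)) \<le> ereal (a * (ln n + ln 2) / ln n)"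
      using m by (simp add: elog_def)
  qed
  then have "limsup (\<lambda>n. - elog (m n) / ereal (ln (real n)))
      \<le> limsup (\<lambda>n. ereal (a * (ln (real n) + ln 2) / ln n))"
    by (rule Limsup_mono)
  also have "(\<lambda>n::nat. a * (ln (real n) + ln 2) / ln n) \<longlonglongrightarrow> a"
    by real_asymp
  then have "limsup (\<lambda>n. ereal (a * (ln (real n) + ln 2) / ln n)) = ereal a"
    by (intro lim_imp_Limsup) auto
  finally show ?thesis .
qed

text \<open>
  The summand is a constant times a polylogarithm of \<open>2\<^sup>k\<close> times \<open>2 powr (k (1 - as))\<close>. Half of
  the exponential decay absorbs the polylogarithm, the other half leaves a geometric series.
\<close>
lemma summable_dyadic_bound:
  fixes a s c C :: real
  assumes "1 < a * s" "0 < c"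
  shows "summable (\<lambda>k. 2 ^ k * (2 * gap c (2 ^ k) + 1) * (C * (4 * 2 powr (- (a * real k))) powr s))"
proof -
  define \<delta> where "\<delta> = (a * s - 1) / 2"
  have \<delta>: "0 < \<delta>" using assms by (simp add: \<delta>_def)
  let ?f = "\<lambda>k::nat. (2 * (real k * ln 2) powr c + 1) * 2 powr (- (\<delta> * real k))"
  have "?f \<longlonglongrightarrow> 0"
    using \<delta> assms(2) by real_asymp
  then have "(\<lambda>k. C * 4 powr s * ?f k) \<longlonglongrightarrow> C * 4 powr s * 0"
    by (rule tendsto_mult_left)
  then have "(\<lambda>k. norm (C * 4 powr s * ?f k)) \<longlonglongrightarrow> norm (C * 4 powr s * 0)"
    by (rule tendsto_norm)
  then have "\<forall>\<^sub>F k in sequentially. norm (C * 4 powr s * ?f k) < 1"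
    by (rule order_tendstoD(2)) simp
  then have "\<forall>\<^sub>F k in sequentially.
      norm (2 ^ k * (2 * gap c (2 ^ k) + 1) * (C * (4 * 2 powr (- (a * real k))) powr s))
        \<le> (2 powr (- \<delta>)) ^ k"
  proof eventually_elim
    fix k :: nat assume *: "norm (C * 4 powr s * ?f k) < 1"
    have "2 ^ k * (2 powr (- (a * real k))) powr s = 2 powr real k * 2 powr (- (a * real k) * s)"
      by (simp only: powr_powr powr_realpow zero_less_numeral)
    also have "\<dots> = 2 powr (real k - a * s * real k)"
      by (simp only: powr_add[symmetric]) (simp add: algebra_simps)
    also have "real k - a * s * real k = - (\<delta> * real k) + - (\<delta> * real k)"
      by (simp add: \<delta>_def field_simps)
    also have "2 powr (- (\<delta> * real k) + - (\<delta> * real k)) = 2 powr (- (\<delta> * real k)) * (2 powr (- \<delta>)) ^ k"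
      by (subst powr_add) (simp add: powr_power mult.commute)
    finally have e: "2 ^ k * (2 powr (- (a * real k))) powr s
        = 2 powr (- (\<delta> * real k)) * (2 powr (- \<delta>)) ^ k" .
    have "2 ^ k * (2 * gap c (2 ^ k) + 1) * (C * (4 * 2 powr (- (a * real k))) powr s)
        = (2 * gap c (2 ^ k) + 1) * C * 4 powr s * (2 ^ k * (2 powr (- (a * real k))) powr s)"
      by (simp only: powr_mult mult_ac)
    also have "\<dots> = (C * 4 powr s * ?f k) * (2 powr (- \<delta>)) ^ k"
      unfolding e by (simp add: gap_def ln_realpow)
    finally have "norm (2 ^ k * (2 * gap c (2 ^ k) + 1) * (C * (4 * 2 powr (- (a * real k))) powr s))
        = norm ((C * 4 powr s * ?f k) * (2 powr (- \<delta>)) ^ k)"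
      by (rule arg_cong)
    also have "\<dots> = norm (C * 4 powr s * ?f k) * (2 powr (- \<delta>)) ^ k"
      by (simp add: abs_mult)
    also have "\<dots> \<le> 1 * (2 powr (- \<delta>)) ^ k"
      using * by (intro mult_right_mono) auto
    finally show "norm (2 ^ k * (2 * gap c (2 ^ k) + 1) * (C * (4 * 2 powr (- (a * real k))) powr s))
        \<le> (2 powr (- \<delta>)) ^ k" by simp
  qed
  moreover have "summable (\<lambda>k. (2 powr (- \<delta>)) ^ k)"
    using \<delta> by (intro summable_geometric) (simp add: powr_minus_divide divide_less_eq)
  ultimately show ?thesis
    by (rule summable_comparison_test_ev)
qed

section \<open>Fibre measures along orbits\<close>

context random_dynamical_system
begin

definition skew :: "'w \<times> 'x \<Rightarrow> 'w \<times> 'x" where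
  "skew = (\<lambda>(\<omega>, x). (\<theta> \<omega>, T \<omega> x))"

definition near :: "real \<Rightarrow> (nat \<times> nat) set \<Rightarrow> 'w \<Rightarrow> ('x \<times> 'x) set" where
  "near r J \<omega> = {(x, y). \<exists>(i, j)\<in>J. dist (rds_iter \<theta> T i \<omega> x) (rds_iter \<theta> T j \<omega> y) < r}"

definition quenched_corr :: "real \<Rightarrow> ennreal" where
  "quenched_corr r = (\<integral>\<^sup>+\<omega>. \<integral>\<^sup>+x. emeasure (\<mu> \<omega>) (ball x r) \<partial>\<mu> \<omega> \<partial>P)"

lemma space_P[simp]: "space P = UNIV"
  using sets_eq_imp_space_eq[OF sets_P] by simp

lemma prob_space_mu: "prob_space (\<mu> \<omega>)"
  and sets_mu: "sets (\<mu> \<omega>) = sets borel"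
  using measurable_space[OF measurable_mu, of \<omega>] by (auto simp: space_prob_algebra)

lemma space_mu[simp]: "space (\<mu> \<omega>) = UNIV"
  using sets_eq_imp_space_eq[OF sets_mu] by simp

lemma kernel_mu[measurable]: "\<mu> \<in> P \<rightarrow>\<^sub>M subprob_algebra borel"
  using measurable_mu by (rule measurable_prob_algebraD)

lemma kernel_mu_pair: "(\<lambda>\<omega>. \<mu> \<omega> \<Otimes>\<^sub>M \<mu> \<omega>) \<in> P \<rightarrow>\<^sub>M subprob_algebra (borel \<Otimes>\<^sub>M borel)"
  by (rule measurable_pair_measure[OF kernel_mu kernel_mu])

lemma prob_space_mu_pair: "prob_space (\<mu> \<omega> \<Otimes>\<^sub>M \<mu> \<omega>)"
  by (rule prob_space_pair[OF prob_space_mu prob_space_mu])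

lemma measurable_theta_power[measurable]: "\<theta> ^^ n \<in> P \<rightarrow>\<^sub>M P"
  by (rule measurable_compose_n[OF measurable_theta])

lemma measurable_skew_power[measurable]: "skew ^^ n \<in> P \<Otimes>\<^sub>M borel \<rightarrow>\<^sub>M P \<Otimes>\<^sub>M borel"
  using measurable_skew unfolding skew_def by (rule measurable_compose_n)

lemma skew_power: "(skew ^^ n) (\<omega>, x) = ((\<theta> ^^ n) \<omega>, rds_iter \<theta> T n \<omega> x)"
  by (induction n) (auto simp: skew_def)

lemma measurable_rds_iter: "rds_iter \<theta> T n \<omega> \<in> borel \<rightarrow>\<^sub>M borel"
proof (induction n)
  case (Suc n)
  from measurable_comp[OF this measurable_T, of "(\<theta> ^^ n) \<omega>"] show ?case by (simp add: comp_def)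
qed (simp add: id_def)

lemma measurable_rds_iter_joint[measurable]:
  "(\<lambda>(\<omega>, x). rds_iter \<theta> T n \<omega> x) \<in> P \<Otimes>\<^sub>M borel \<rightarrow>\<^sub>M borel"
proof -
  have "(\<lambda>z. snd ((skew ^^ n) z)) \<in> P \<Otimes>\<^sub>M borel \<rightarrow>\<^sub>M borel" by measurable
  also have "(\<lambda>z. snd ((skew ^^ n) z)) = (\<lambda>(\<omega>, x). rds_iter \<theta> T n \<omega> x)"
    by (auto simp: skew_power)
  finally show ?thesis .
qed

lemma distr_theta_power: "distr P P (\<theta> ^^ n) = P"
proof (induction n)
  case 0
  then show ?case by (simp add: distr_id2 id_def)
next
  case (Suc n)
  have "distr P P (\<theta> ^^ Suc n) = distr (distr P P (\<theta> ^^ n)) P \<theta>"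
    by (subst distr_distr) (auto simp: measurable_theta)
  also have "\<dots> = P" by (simp only: Suc preserves_P)
  finally show ?case .
qed

lemma distr_skew_power: "distr \<nu> \<nu> (skew ^^ n) = \<nu>"
proof (induction n)
  case 0
  then show ?case by (simp add: distr_id2 id_def)
next
  case (Suc n)
  have m: "skew ^^ n \<in> \<nu> \<rightarrow>\<^sub>M \<nu>" "skew \<in> \<nu> \<rightarrow>\<^sub>M \<nu>"
    using measurable_skew_power[of n] measurable_skew_power[of 1] sets_nu
    by (auto simp: cong: measurable_cong_sets)
  have "distr \<nu> \<nu> (skew ^^ Suc n) = distr (distr \<nu> \<nu> (skew ^^ n)) \<nu> skew"
    by (subst distr_distr) (auto simp: m)
  also have "\<dots> = \<nu>" by (simp only: Suc preserves_nu[folded skew_def])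
  finally show ?case .
qed

lemma measurable_mu_preimage[measurable]:
  assumes [measurable]: "B \<in> sets borel"
  shows "(\<lambda>\<omega>. emeasure (\<mu> \<omega>) (rds_iter \<theta> T n \<omega> -` B)) \<in> borel_measurable P"
proof (rule emeasure_measurable_subprob_algebra2[OF _ kernel_mu])
  have "(\<lambda>(\<omega>, x). rds_iter \<theta> T n \<omega> x) -` B \<inter> space (P \<Otimes>\<^sub>M borel) \<in> sets (P \<Otimes>\<^sub>M borel)"
    by measurable
  also have "(\<lambda>(\<omega>, x). rds_iter \<theta> T n \<omega> x) -` B \<inter> space (P \<Otimes>\<^sub>M borel)
      = (SIGMA \<omega>:space P. rds_iter \<theta> T n \<omega> -` B)"
    by (auto simp: space_pair_measure)
  finally show "(SIGMA \<omega>:space P. rds_iter \<theta> T n \<omega> -` B) \<in> sets (P \<Otimes>\<^sub>M borel)" .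
qed

text \<open>
  Equivariance of the fibre measures. Both sides are functions of \<open>\<omega>\<close> with the same integral over
  every base set \<open>A\<close>: invertibility of \<open>\<theta>\<close> writes \<open>A\<close> as the preimage of a base set \<open>A'\<close> under
  \<open>\<theta> ^^ n\<close>, and the two integrals are then the \<open>\<nu>\<close>-masses of \<open>A' \<times> B\<close> and of its preimage under
  the skew product. The exceptional null set may depend on \<open>B\<close>.
\<close>
lemma mu_preimage_AE:
  assumes [measurable]: "B \<in> sets borel"
  shows "AE \<omega> in P. emeasure (\<mu> \<omega>) (rds_iter \<theta> T n \<omega> -` B) = emeasure (\<mu> ((\<theta> ^^ n) \<omega>)) B"
proof -
  interpret prob_space P by (rule prob_P)
  show ?thesis
  proof (rule density_unique_finite_measure)
    fix A assume A[measurable]: "A \<in> sets P"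
    define A' where "A' = (inv \<theta> ^^ n) -` A"
    have [measurable]: "A' \<in> sets P"
      using measurable_sets[OF measurable_compose_n[OF measurable_inv_theta] A, of n]
      by (simp add: A'_def)
    have inv: "(inv \<theta> ^^ n) ((\<theta> ^^ n) \<omega>) = \<omega>" for \<omega>
      using bij_theta inv_fn[of \<theta> n] inv_f_f[of "\<theta> ^^ n" \<omega>] bij_fn[of \<theta> n]
      by (simp add: bij_is_inj)
    have mem: "(\<theta> ^^ n) \<omega> \<in> A' \<longleftrightarrow> \<omega> \<in> A" for \<omega>
      by (simp add: A'_def inv)
    let ?h = "\<lambda>z. indicator (A' \<times> B) z :: ennreal"
    have [measurable]: "rds_iter \<theta> T n \<omega> -` B \<in> sets (\<mu> \<omega>)" for \<omega>
      using measurable_sets[OF measurable_rds_iter, of B n \<omega>] by (simp add: sets_mu)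
    have [measurable]: "B \<in> sets (\<mu> \<omega>)" for \<omega>
      by (simp add: sets_mu)
    have "(\<integral>\<^sup>+\<omega>. emeasure (\<mu> \<omega>) (rds_iter \<theta> T n \<omega> -` B) * indicator A \<omega> \<partial>P)
        = (\<integral>\<^sup>+\<omega>. \<integral>\<^sup>+x. ?h ((skew ^^ n) (\<omega>, x)) \<partial>\<mu> \<omega> \<partial>P)"
    proof (intro nn_integral_cong)
      fix \<omega>
      have "(\<integral>\<^sup>+x. ?h ((skew ^^ n) (\<omega>, x)) \<partial>\<mu> \<omega>)
          = (\<integral>\<^sup>+x. indicator A \<omega> * indicator (rds_iter \<theta> T n \<omega> -` B) x \<partial>\<mu> \<omega>)"
        by (intro nn_integral_cong) (auto simp: skew_power indicator_def mem)
      then show "emeasure (\<mu> \<omega>) (rds_iter \<theta> T n \<omega> -` B) * indicator A \<omega>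
          = (\<integral>\<^sup>+x. ?h ((skew ^^ n) (\<omega>, x)) \<partial>\<mu> \<omega>)"
        by (simp add: nn_integral_cmult mult.commute)
    qed
    also have "\<dots> = (\<integral>\<^sup>+z. ?h ((skew ^^ n) z) \<partial>\<nu>)"
      by (rule disintegration[symmetric]) measurable
    also have "\<dots> = (\<integral>\<^sup>+z. ?h z \<partial>distr \<nu> \<nu> (skew ^^ n))"
    proof (rule nn_integral_distr[symmetric])
      show "skew ^^ n \<in> \<nu> \<rightarrow>\<^sub>M \<nu>"
        using measurable_skew_power[of n] sets_nu by (simp cong: measurable_cong_sets)
      show "?h \<in> borel_measurable (distr \<nu> \<nu> (skew ^^ n))"
        by (simp add: sets_nu borel_measurable_indicator)
    qed
    also have "\<dots> = (\<integral>\<^sup>+\<omega>. \<integral>\<^sup>+x. ?h (\<omega>, x) \<partial>\<mu> \<omega> \<partial>P)"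
      unfolding distr_skew_power by (rule disintegration) measurable
    also have "\<dots> = (\<integral>\<^sup>+\<omega>. indicator A' \<omega> * emeasure (\<mu> \<omega>) B \<partial>P)"
      by (simp add: indicator_times nn_integral_cmult)
    also have "\<dots> = (\<integral>\<^sup>+\<omega>. indicator A' \<omega> * emeasure (\<mu> \<omega>) B \<partial>distr P P (\<theta> ^^ n))"
      by (simp add: distr_theta_power)
    also have "\<dots> = (\<integral>\<^sup>+\<omega>. emeasure (\<mu> ((\<theta> ^^ n) \<omega>)) B * indicator A \<omega> \<partial>P)"
      by (subst nn_integral_distr) (auto simp: indicator_def mem intro!: nn_integral_cong)
    finally show "(\<integral>\<^sup>+\<omega>. emeasure (\<mu> \<omega>) (rds_iter \<theta> T n \<omega> -` B) * indicator A \<omega> \<partial>P)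
        = (\<integral>\<^sup>+\<omega>. emeasure (\<mu> ((\<theta> ^^ n) \<omega>)) B * indicator A \<omega> \<partial>P)" .
  qed (auto intro!: measurable_compose[OF measurable_theta_power])
qed

lemma nn_integral_mu_preimage_square:
  assumes [measurable]: "B \<in> sets borel"
  shows "(\<integral>\<^sup>+\<omega>. (emeasure (\<mu> \<omega>) (rds_iter \<theta> T n \<omega> -` B))\<^sup>2 \<partial>P)
           = (\<integral>\<^sup>+\<omega>. (emeasure (\<mu> \<omega>) B)\<^sup>2 \<partial>P)"
proof -
  have "(\<integral>\<^sup>+\<omega>. (emeasure (\<mu> \<omega>) (rds_iter \<theta> T n \<omega> -` B))\<^sup>2 \<partial>P)
      = (\<integral>\<^sup>+\<omega>. (emeasure (\<mu> ((\<theta> ^^ n) \<omega>)) B)\<^sup>2 \<partial>P)"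
    using mu_preimage_AE[OF assms, of n] by (intro nn_integral_cong_AE) auto
  also have "\<dots> = (\<integral>\<^sup>+\<omega>. (emeasure (\<mu> \<omega>) B)\<^sup>2 \<partial>distr P P (\<theta> ^^ n))"
    by (subst nn_integral_distr) auto
  finally show ?thesis by (simp add: distr_theta_power)
qed

text \<open>
  The measures of the two preimages belong to the different fibres over \<open>\<theta>\<^sup>i \<omega>\<close> and \<open>\<theta>\<^sup>j \<omega>\<close>. The
  inequality \<open>2ab \<le> a\<^sup>2 + b\<^sup>2\<close> separates them, after which stationarity forgets \<open>i\<close> and \<open>j\<close>.
\<close>
lemma nn_integral_mu_preimage_mult_le:
  assumes [measurable]: "B \<in> sets borel"
  shows "(\<integral>\<^sup>+\<omega>. emeasure (\<mu> \<omega>) (rds_iter \<theta> T i \<omega> -` B) * emeasure (\<mu> \<omega>) (rds_iter \<theta> T j \<omega> -` B) \<partial>P)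
           \<le> (\<integral>\<^sup>+\<omega>. (emeasure (\<mu> \<omega>) B)\<^sup>2 \<partial>P)"
proof -
  let ?f = "\<lambda>i \<omega>. emeasure (\<mu> \<omega>) (rds_iter \<theta> T i \<omega> -` B)"
  have "2 * (\<integral>\<^sup>+\<omega>. ?f i \<omega> * ?f j \<omega> \<partial>P) = (\<integral>\<^sup>+\<omega>. 2 * (?f i \<omega> * ?f j \<omega>) \<partial>P)"
    by (rule nn_integral_cmult[symmetric]) measurable
  also have "\<dots> \<le> (\<integral>\<^sup>+\<omega>. (?f i \<omega>)\<^sup>2 + (?f j \<omega>)\<^sup>2 \<partial>P)"
    by (intro nn_integral_mono two_mult_le_sum_squares_ennreal)
  also have "\<dots> = (\<integral>\<^sup>+\<omega>. (?f i \<omega>)\<^sup>2 \<partial>P) + (\<integral>\<^sup>+\<omega>. (?f j \<omega>)\<^sup>2 \<partial>P)"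
    by (rule nn_integral_add) measurable
  also have "\<dots> = 2 * (\<integral>\<^sup>+\<omega>. (emeasure (\<mu> \<omega>) B)\<^sup>2 \<partial>P)"
    by (simp add: nn_integral_mu_preimage_square mult_2)
  finally show ?thesis
    by (simp add: ennreal_mult_le_mult_iff)
qed

section \<open>Expected probability of a close encounter\<close>

lemma sets_near:
  assumes "compact (UNIV :: 'x set)" and "finite J"
  shows "(SIGMA \<omega>:space P. near r J \<omega>) \<in> sets (P \<Otimes>\<^sub>M (borel \<Otimes>\<^sub>M borel))"
proof -
  let ?g = "\<lambda>(i, j) z. (rds_iter \<theta> T i (fst z) (fst (snd z)), rds_iter \<theta> T j (fst z) (snd (snd z)))"
  have iter: "(\<lambda>z. rds_iter \<theta> T i (f z) (g z)) \<in> M \<rightarrow>\<^sub>M borel"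
    if "f \<in> M \<rightarrow>\<^sub>M P" "g \<in> M \<rightarrow>\<^sub>M borel" for i f g and M :: "('w \<times> 'x \<times> 'x) measure"
    using measurable_compose[OF measurable_Pair[OF that] measurable_rds_iter_joint[of i]] by simp
  have g: "?g p \<in> P \<Otimes>\<^sub>M (borel \<Otimes>\<^sub>M borel) \<rightarrow>\<^sub>M borel \<Otimes>\<^sub>M borel" for p
    by (cases p) (auto intro!: measurable_Pair iter)
  have "(\<Union>p\<in>J. ?g p -` {(x, y). dist x y < r} \<inter> space (P \<Otimes>\<^sub>M (borel \<Otimes>\<^sub>M borel)))
      \<in> sets (P \<Otimes>\<^sub>M (borel \<Otimes>\<^sub>M borel))"
    using \<open>finite J\<close> by (intro sets.finite_UN measurable_sets[OF g] sets_dist_less assms(1))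
  also have "(\<Union>p\<in>J. ?g p -` {(x, y). dist x y < r} \<inter> space (P \<Otimes>\<^sub>M (borel \<Otimes>\<^sub>M borel)))
      = (SIGMA \<omega>:space P. near r J \<omega>)"
    unfolding near_def space_pair_measure by auto blast+
  finally show ?thesis .
qed

lemma measurable_mu_ball:
  assumes "compact (UNIV :: 'x set)"
  shows "(\<lambda>(\<omega>, x). emeasure (\<mu> \<omega>) (ball x r)) \<in> borel_measurable (P \<Otimes>\<^sub>M borel)"
proof -
  have "(\<lambda>z. (snd (fst z), snd z)) -` {(x :: 'x, y). dist x y < r} \<inter> space ((P \<Otimes>\<^sub>M borel) \<Otimes>\<^sub>M borel)
      \<in> sets ((P \<Otimes>\<^sub>M borel) \<Otimes>\<^sub>M borel)"
    by (rule measurable_sets[OF _ sets_dist_less[OF assms]]) measurable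
  also have "(\<lambda>z. (snd (fst z), snd z)) -` {(x :: 'x, y). dist x y < r} \<inter> space ((P \<Otimes>\<^sub>M borel) \<Otimes>\<^sub>M borel)
      = (SIGMA z:space (P \<Otimes>\<^sub>M borel). ball (snd z) r)"
    by (auto simp: space_pair_measure)
  finally show ?thesis
    unfolding case_prod_beta'
    by (rule emeasure_measurable_subprob_algebra2) measurable
qed

lemma measurable_mu_ball_fibre:
  assumes "compact (UNIV :: 'x set)"
  shows "(\<lambda>x. emeasure (\<mu> \<omega>) (ball x r)) \<in> borel_measurable borel"
  using measurable_compose[OF measurable_Pair1' measurable_mu_ball[OF assms, of r], of \<omega>] by simp

lemma measurable_fibre_correlation:
  assumes "compact (UNIV :: 'x set)"
  shows "(\<lambda>\<omega>. \<integral>\<^sup>+x. emeasure (\<mu> \<omega>) (ball x r) \<partial>\<mu> \<omega>) \<in> borel_measurable P"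
  by (rule nn_integral_measurable_subprob_algebra2[OF measurable_mu_ball[OF assms] kernel_mu])

lemma fibre_correlation_le_1: "(\<integral>\<^sup>+x. emeasure (\<mu> \<omega>) (ball x r) \<partial>\<mu> \<omega>) \<le> 1"
proof -
  interpret prob_space "\<mu> \<omega>" by (rule prob_space_mu)
  have "(\<integral>\<^sup>+x. emeasure (\<mu> \<omega>) (ball x r) \<partial>\<mu> \<omega>) \<le> (\<integral>\<^sup>+x. 1 \<partial>\<mu> \<omega>)"
    by (intro nn_integral_mono) (rule emeasure_le_1)
  then show ?thesis using emeasure_space_1 by simp
qed

lemma quenched_corr_le_1: "quenched_corr r \<le> 1"
proof -
  interpret prob_space P by (rule prob_P)
  have "quenched_corr r \<le> (\<integral>\<^sup>+\<omega>. 1 \<partial>P)"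
    unfolding quenched_corr_def by (intro nn_integral_mono fibre_correlation_le_1)
  then show ?thesis using emeasure_space_1 by simp
qed

text \<open>
  The dimension is defined through Bochner integrals, which vanish on functions that are not
  integrable; measurability of the ball masses in \<open>(\<omega>, x)\<close> excludes this degenerate case.
\<close>
lemma integral_eq_quenched_corr:
  assumes "compact (UNIV :: 'x set)"
  shows "(\<integral>\<omega>. (\<integral>x. measure (\<mu> \<omega>) (ball x r) \<partial>\<mu> \<omega>) \<partial>P) = enn2real (quenched_corr r)"
proof -
  have inner: "(\<integral>x. measure (\<mu> \<omega>) (ball x r) \<partial>\<mu> \<omega>) = enn2real (\<integral>\<^sup>+x. emeasure (\<mu> \<omega>) (ball x r) \<partial>\<mu> \<omega>)" for \<omega>
  proof -
    interpret prob_space "\<mu> \<omega>" by (rule prob_space_mu)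
    have "(\<lambda>x. measure (\<mu> \<omega>) (ball x r)) \<in> borel_measurable (\<mu> \<omega>)"
      unfolding measure_def measurable_cong_sets[OF sets_mu refl]
      by (intro borel_measurable_enn2real measurable_mu_ball_fibre assms)
    then have "(\<integral>x. measure (\<mu> \<omega>) (ball x r) \<partial>\<mu> \<omega>)
        = enn2real (\<integral>\<^sup>+x. ennreal (measure (\<mu> \<omega>) (ball x r)) \<partial>\<mu> \<omega>)"
      by (rule integral_eq_nn_integral) simp
    then show ?thesis by (simp only: emeasure_eq_measure)
  qed
  have "(\<integral>\<omega>. enn2real (\<integral>\<^sup>+x. emeasure (\<mu> \<omega>) (ball x r) \<partial>\<mu> \<omega>) \<partial>P)
      = enn2real (\<integral>\<^sup>+\<omega>. ennreal (enn2real (\<integral>\<^sup>+x. emeasure (\<mu> \<omega>) (ball x r) \<partial>\<mu> \<omega>)) \<partial>P)"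
    by (intro integral_eq_nn_integral borel_measurable_enn2real measurable_fibre_correlation assms AE_I2
        enn2real_nonneg)
  also have "(\<integral>\<^sup>+\<omega>. ennreal (enn2real (\<integral>\<^sup>+x. emeasure (\<mu> \<omega>) (ball x r) \<partial>\<mu> \<omega>)) \<partial>P) = quenched_corr r"
    unfolding quenched_corr_def
  proof (intro nn_integral_cong ennreal_enn2real)
    fix \<omega> show "(\<integral>\<^sup>+x. emeasure (\<mu> \<omega>) (ball x r) \<partial>\<mu> \<omega>) < top"
      using fibre_correlation_le_1[where r = r and \<omega> = \<omega>] by (rule le_less_trans) simp
  qed
  finally show ?thesis by (simp add: inner)
qed

text \<open>
  The key estimate. Two points at distance less than \<open>r\<close> lie in a common ball of radius \<open>2r\<close> around
  a centre of the cover, so the encounter event is covered by the rectangles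
  \<open>T\<^sup>-\<^sup>i B \<times> T\<^sup>-\<^sup>j B\<close>, whose product measure factorises on each fibre.
\<close>
lemma nn_integral_near_le:
  assumes compact: "compact (UNIV :: 'x set)" and J: "finite J" and r: "0 < r"
    and cover: "UNIV \<subseteq> (\<Union>p\<in>{1..k}. ball (c (p :: nat) :: 'x) r)"
    and mult: "\<And>x. card {p \<in> {1..k}. x \<in> ball (c p) (4 * r)} \<le> C"
  shows "(\<integral>\<^sup>+\<omega>. emeasure (\<mu> \<omega> \<Otimes>\<^sub>M \<mu> \<omega>) (near r J \<omega>) \<partial>P)
           \<le> of_nat (card J) * (of_nat C * quenched_corr (4 * r))"
proof -
  let ?A = "\<lambda>n p \<omega>. rds_iter \<theta> T n \<omega> -` ball (c p) (2 * r)"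
  let ?I = "J \<times> {1..k}"
  have [measurable]: "ball x s \<in> sets borel" for x :: 'x and s by simp
  have A: "?A n p \<omega> \<in> sets (\<mu> \<omega>)" for n p \<omega>
    using measurable_sets[OF measurable_rds_iter, of "ball (c p) (2 * r)" n \<omega>] by (simp add: sets_mu)
  have "emeasure (\<mu> \<omega> \<Otimes>\<^sub>M \<mu> \<omega>) (near r J \<omega>)
      \<le> (\<Sum>((i, j), p)\<in>?I. emeasure (\<mu> \<omega>) (?A i p \<omega>) * emeasure (\<mu> \<omega>) (?A j p \<omega>))" for \<omega>
  proof -
    interpret prob_space "\<mu> \<omega>" by (rule prob_space_mu)
    have "near r J \<omega> \<subseteq> (\<Union>((i, j), p)\<in>?I. ?A i p \<omega> \<times> ?A j p \<omega>)"
    proof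
      fix z assume "z \<in> near r J \<omega>"
      then obtain x y i j where z: "z = (x, y)" and ij: "(i, j) \<in> J"
        and d: "dist (rds_iter \<theta> T i \<omega> x) (rds_iter \<theta> T j \<omega> y) < r"
        by (auto simp: near_def)
      obtain p where p: "p \<in> {1..k}" "dist (c p) (rds_iter \<theta> T i \<omega> x) < r"
        using subsetD[OF cover UNIV_I[of "rds_iter \<theta> T i \<omega> x"]] by auto
      have "dist (c p) (rds_iter \<theta> T j \<omega> y) < 2 * r"
        using dist_triangle[of "c p" "rds_iter \<theta> T j \<omega> y" "rds_iter \<theta> T i \<omega> x"] p d by linarith
      with p r have "z \<in> ?A i p \<omega> \<times> ?A j p \<omega>" by (simp add: z)
      with ij p show "z \<in> (\<Union>((i, j), p)\<in>?I. ?A i p \<omega> \<times> ?A j p \<omega>)"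
        by (intro UN_I[of "((i, j), p)"]) auto
    qed
    then have "emeasure (\<mu> \<omega> \<Otimes>\<^sub>M \<mu> \<omega>) (near r J \<omega>)
        \<le> emeasure (\<mu> \<omega> \<Otimes>\<^sub>M \<mu> \<omega>) (\<Union>((i, j), p)\<in>?I. ?A i p \<omega> \<times> ?A j p \<omega>)"
      using A J by (intro emeasure_mono sets.finite_UN) (auto intro!: finite_cartesian_product)
    also have "\<dots> \<le> (\<Sum>((i, j), p)\<in>?I. emeasure (\<mu> \<omega> \<Otimes>\<^sub>M \<mu> \<omega>) (?A i p \<omega> \<times> ?A j p \<omega>))"
      using emeasure_subadditive_finite[of ?I "\<lambda>((i, j), p). ?A i p \<omega> \<times> ?A j p \<omega>" "\<mu> \<omega> \<Otimes>\<^sub>M \<mu> \<omega>"] A J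
      by (auto simp: case_prod_beta' image_subset_iff)
    also have "\<dots> = (\<Sum>((i, j), p)\<in>?I. emeasure (\<mu> \<omega>) (?A i p \<omega>) * emeasure (\<mu> \<omega>) (?A j p \<omega>))"
      using A by (intro sum.cong) (auto simp: emeasure_pair_measure_Times)
    finally show ?thesis .
  qed
  then have "(\<integral>\<^sup>+\<omega>. emeasure (\<mu> \<omega> \<Otimes>\<^sub>M \<mu> \<omega>) (near r J \<omega>) \<partial>P)
      \<le> (\<integral>\<^sup>+\<omega>. (\<Sum>((i, j), p)\<in>?I. emeasure (\<mu> \<omega>) (?A i p \<omega>) * emeasure (\<mu> \<omega>) (?A j p \<omega>)) \<partial>P)"
    by (intro nn_integral_mono)
  also have "\<dots> = (\<Sum>((i, j), p)\<in>?I. \<integral>\<^sup>+\<omega>. emeasure (\<mu> \<omega>) (?A i p \<omega>) * emeasure (\<mu> \<omega>) (?A j p \<omega>) \<partial>P)"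
    unfolding case_prod_beta' by (rule nn_integral_sum) measurable
  also have "\<dots> \<le> (\<Sum>((i, j), p)\<in>?I. \<integral>\<^sup>+\<omega>. (emeasure (\<mu> \<omega>) (ball (c p) (2 * r)))\<^sup>2 \<partial>P)"
    by (intro sum_mono) (auto intro!: nn_integral_mu_preimage_mult_le)
  also have "\<dots> = (\<Sum>_\<in>J. \<Sum>p\<in>{1..k}. \<integral>\<^sup>+\<omega>. (emeasure (\<mu> \<omega>) (ball (c p) (2 * r)))\<^sup>2 \<partial>P)"
    by (subst sum.cartesian_product) (simp add: case_prod_beta')
  also have "\<dots> = of_nat (card J) * (\<Sum>p\<in>{1..k}. \<integral>\<^sup>+\<omega>. (emeasure (\<mu> \<omega>) (ball (c p) (2 * r)))\<^sup>2 \<partial>P)"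
    by simp
  also have "(\<Sum>p\<in>{1..k}. \<integral>\<^sup>+\<omega>. (emeasure (\<mu> \<omega>) (ball (c p) (2 * r)))\<^sup>2 \<partial>P)
      = (\<integral>\<^sup>+\<omega>. (\<Sum>p\<in>{1..k}. (emeasure (\<mu> \<omega>) (ball (c p) (2 * r)))\<^sup>2) \<partial>P)"
    by (rule nn_integral_sum[symmetric]) measurable
  also have "\<dots> \<le> (\<integral>\<^sup>+\<omega>. of_nat C * (\<integral>\<^sup>+x. emeasure (\<mu> \<omega>) (ball x (4 * r)) \<partial>\<mu> \<omega>) \<partial>P)"
    by (intro nn_integral_mono sum_squares_ball_le_correlation prob_space_mu sets_mu
        measurable_mu_ball_fibre compact r mult)
  also have "\<dots> = of_nat C * quenched_corr (4 * r)"
    unfolding quenched_corr_def by (intro nn_integral_cmult measurable_fibre_correlation compact)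
  finally show ?thesis by (simp add: mult_left_mono)
qed

section \<open>The correlation dimension as a rate of decay\<close>

lemma lower_quenched_corr_dim_nonneg:
  assumes "compact (UNIV :: 'x set)"
  shows "0 \<le> lower_quenched_corr_dim P \<mu>"
  unfolding lower_quenched_corr_dim_def integral_eq_quenched_corr[OF assms]
proof (rule Liminf_bounded)
  have "eventually (\<lambda>r::real. r < 1) (at_right 0)"
    by (rule eventually_at_right_field[THEN iffD2]) (auto intro: exI[of _ 1])
  moreover have "eventually (\<lambda>r::real. 0 < r) (at_right 0)"
    by (rule eventually_at_right_less)
  ultimately show "\<forall>\<^sub>F r in at_right 0. 0 \<le> elog (enn2real (quenched_corr r)) / elog r"
  proof eventually_elim
    fix r :: real assume r: "r < 1" "0 < r"
    have "enn2real (quenched_corr r) \<le> 1"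
      using quenched_corr_le_1[of r] by (simp add: enn2real_leI)
    then have "elog (enn2real (quenched_corr r)) \<le> 0"
      by (auto simp: elog_def less_le)
    moreover have "elog r < 0" using r by (simp add: elog_def)
    ultimately show "0 \<le> elog (enn2real (quenched_corr r)) / elog r"
      using r by (cases "elog (enn2real (quenched_corr r))") (auto simp: elog_def divide_nonpos_neg)
  qed
qed

lemma eventually_quenched_corr_le_powr:
  assumes "compact (UNIV :: 'x set)" and s: "ereal s < lower_quenched_corr_dim P \<mu>"
  shows "\<forall>\<^sub>F r in at_right 0. quenched_corr r \<le> ennreal (r powr s)"
proof -
  have "\<forall>\<^sub>F r in at_right 0. ereal s < elog (enn2real (quenched_corr r)) / elog r"
    using s unfolding lower_quenched_corr_dim_def integral_eq_quenched_corr[OF assms(1)]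
    by (rule less_LiminfD)
  moreover have "eventually (\<lambda>r::real. r < 1) (at_right 0)"
    by (rule eventually_at_right_field[THEN iffD2]) (auto intro: exI[of _ 1])
  moreover have "eventually (\<lambda>r::real. 0 < r) (at_right 0)"
    by (rule eventually_at_right_less)
  ultimately show ?thesis
  proof eventually_elim
    fix r :: real assume *: "ereal s < elog (enn2real (quenched_corr r)) / elog r" and r: "r < 1" "0 < r"
    have fin: "quenched_corr r < top"
      using quenched_corr_le_1[of r] by (rule le_less_trans) simp
    show "quenched_corr r \<le> ennreal (r powr s)"
    proof (cases "enn2real (quenched_corr r) = 0")
      case True
      then show ?thesis using fin by (auto simp: enn2real_eq_0_iff)
    next
      case False
      then have pos: "0 < enn2real (quenched_corr r)" by (simp add: order_less_le)
      have "s < ln (enn2real (quenched_corr r)) / ln r"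
        using * False r by (simp add: elog_def)
      then have "ln (enn2real (quenched_corr r)) < s * ln r"
        using r by (simp add: neg_less_divide_eq)
      then have "enn2real (quenched_corr r) < r powr s"
        using pos r by (simp add: powr_def flip: exp_less_cancel_iff[of "ln (enn2real (quenched_corr r))"])
      then show ?thesis
        using fin by (metis ennreal_enn2real ennreal_leI less_imp_le)
    qed
  qed
qed

section \<open>Close encounters along dyadic times\<close>

lemma summable_near_dyadic:
  assumes compact: "compact (UNIV :: 'x set)"
    and blc: "bounded_local_complexity (UNIV :: 'x set)"
    and s: "ereal s < lower_quenched_corr_dim P \<mu>"
    and as: "0 < a" "1 < a * s" and c: "0 < c"
  shows "(\<Sum>k. \<integral>\<^sup>+\<omega>. emeasure (\<mu> \<omega> \<Otimes>\<^sub>M \<mu> \<omega>)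
           (near (2 powr (- (a * real k))) (gap_pairs (gap c (2 ^ k)) (2 ^ k)) \<omega>) \<partial>P) \<noteq> top"
    (is "(\<Sum>k. ?e k) \<noteq> top")
proof -
  interpret P: prob_space P by (rule prob_P)
  obtain C :: nat and r0 :: real where r0: "0 < r0"
    and cover: "\<And>r. 0 < r \<Longrightarrow> r < r0 \<Longrightarrow> \<exists>(k::nat) c. UNIV \<subseteq> (\<Union>p\<in>{1..k}. ball (c p :: 'x) r) \<and>
      (\<forall>x. card {p \<in> {1..k}. x \<in> ball (c p) (4 * r)} \<le> C)"
    using blc unfolding bounded_local_complexity_def by auto blast
  let ?r = "\<lambda>k::nat. 2 powr (- (a * real k)) :: real"
  let ?b = "\<lambda>k::nat. 2 ^ k * (2 * gap c (2 ^ k) + 1) * (real C * (4 * ?r k) powr s)"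
  have "?r \<longlonglongrightarrow> 0" using as by real_asymp
  then have small: "\<forall>\<^sub>F k in sequentially. ?r k < r0"
    using r0 by (rule order_tendstoD)
  have "filterlim (\<lambda>k. 4 * ?r k) (at_right 0) sequentially"
    using as by real_asymp
  then have "\<forall>\<^sub>F k in sequentially. quenched_corr (4 * ?r k) \<le> ennreal ((4 * ?r k) powr s)"
    by (rule eventually_compose_filterlim[OF eventually_quenched_corr_le_powr[OF compact s]])
  with small have e_le_b: "\<forall>\<^sub>F k in sequentially. ?e k \<le> ennreal (?b k)"
  proof eventually_elim
    fix k assume small: "?r k < r0" and corr: "quenched_corr (4 * ?r k) \<le> ennreal ((4 * ?r k) powr s)"
    let ?J = "gap_pairs (gap c (2 ^ k)) (2 ^ k)"
    obtain l :: nat and ctr where l: "UNIV \<subseteq> (\<Union>p\<in>{1..l}. ball (ctr p :: 'x) (?r k))"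
      "\<And>x. card {p \<in> {1..l}. x \<in> ball (ctr p) (4 * ?r k)} \<le> C"
      using cover[OF _ small] by auto
    have "?e k \<le> of_nat (card ?J) * (of_nat C * quenched_corr (4 * ?r k))"
      by (rule nn_integral_near_le[OF compact _ _ l]) auto
    also have "\<dots> \<le> of_nat (card ?J) * (of_nat C * ennreal ((4 * ?r k) powr s))"
      by (intro mult_left_mono corr) auto
    also have "\<dots> = ennreal (real (card ?J) * (real C * (4 * ?r k) powr s))"
      by (simp add: ennreal_mult ennreal_of_nat_eq_real_of_nat)
    also have "\<dots> \<le> ennreal (?b k)"
      using card_gap_pairs_le[OF gap_nonneg, of c "2 ^ k" "2 ^ k"]
      by (intro ennreal_leI mult_right_mono) auto
    finally show "?e k \<le> ennreal (?b k)" .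
  qed
  have e_le_1: "?e k \<le> 1" for k
  proof -
    have "?e k \<le> (\<integral>\<^sup>+\<omega>. 1 \<partial>P)"
      by (intro nn_integral_mono prob_space.emeasure_le_1 prob_space_mu_pair)
    then show ?thesis using P.emeasure_space_1 by simp
  qed
  have e: "?e k = ennreal (enn2real (?e k))" for k
    using le_less_trans[OF e_le_1[of k]] by (simp add: ennreal_enn2real)
  have "\<forall>\<^sub>F k in sequentially. norm (enn2real (?e k)) \<le> ?b k"
    using e_le_b by eventually_elim (auto intro!: enn2real_leI mult_nonneg_nonneg add_nonneg_nonneg gap_nonneg)
  then have "summable (\<lambda>k. enn2real (?e k))"
    by (rule summable_comparison_test_ev) (rule summable_dyadic_bound[OF as(2) c])
  then have "(\<Sum>k. ennreal (enn2real (?e k))) \<noteq> top"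
    by (rule ennreal_suminf_neq_top) simp
  then show ?thesis using e by simp
qed

lemma limsup_min_dist_le_AE:
  assumes compact: "compact (UNIV :: 'x set)"
    and blc: "bounded_local_complexity (UNIV :: 'x set)"
    and s: "ereal s < lower_quenched_corr_dim P \<mu>"
    and as: "0 < a" "1 < a * s" and c: "0 < c"
  shows "AE \<omega> in P. AE (x, y) in \<mu> \<omega> \<Otimes>\<^sub>M \<mu> \<omega>.
           limsup (\<lambda>n. - elog (min_dist_le \<theta> T (gap c) n \<omega> x y) / ereal (ln (real n))) \<le> ereal a"
proof -
  let ?E = "\<lambda>k. near (2 powr (- (a * real k))) (gap_pairs (gap c (2 ^ k)) (2 ^ k))"
  have "AE \<omega> in P. AE z in \<mu> \<omega> \<Otimes>\<^sub>M \<mu> \<omega>. \<forall>\<^sub>F k in sequentially. z \<notin> ?E k \<omega>"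
    by (rule kernel_borel_cantelli[OF kernel_mu_pair sets_near summable_near_dyadic])
      (use assms in auto)
  moreover have "limsup (\<lambda>n. - elog (min_dist_le \<theta> T (gap c) n \<omega> x y) / ereal (ln (real n))) \<le> ereal a"
    if ev: "\<forall>\<^sub>F k in sequentially. (x, y) \<notin> ?E k \<omega>" for \<omega> x y
  proof (rule limsup_le_of_dyadic_lower_bound)
    show "\<forall>\<^sub>F k in sequentially. 2 powr (- (a * real k)) \<le> min_dist_le \<theta> T (gap c) (2 ^ k) \<omega> x y"
      using ev
    proof eventually_elim
      fix k assume "(x, y) \<notin> ?E k \<omega>"
      moreover have "gap_pairs (gap c (2 ^ k)) (2 ^ k) \<noteq> {}"
        using zero_in_gap_pairs[of "2 ^ k" "gap c (2 ^ k)"] gap_nonneg by auto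
      ultimately show "2 powr (- (a * real k)) \<le> min_dist_le \<theta> T (gap c) (2 ^ k) \<omega> x y"
        unfolding min_dist_le_eq_Min_image by (subst Min_ge_iff) (auto simp: near_def not_less)
    qed
  qed (use as c in \<open>auto intro: min_dist_le_antimono\<close>)
  ultimately show ?thesis
    by (auto elim!: eventually_mono)
qed

end

text \<open>
  Any rate \<open>a\<close> above \<open>1 / D\<close> leaves room for a decay exponent \<open>s\<close> below \<open>D\<close> that still satisfies
  \<open>as > 1\<close>, the condition under which the encounter probabilities are summable.
\<close>
lemma ereal_inverse_less_imp_less:
  fixes D :: ereal
  assumes "0 < D" "1 / D < ereal a"
  obtains s where "ereal s < D" "0 < a" "1 < a * s"
proof (cases D)
  case (real d)
  then have d: "0 < d" "1 / d < a" using assms by (auto simp: one_ereal_def)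
  moreover from d have "0 < a" using zero_less_divide_1_iff[of d] by linarith
  ultimately have "1 / a < d" by (simp add: field_simps)
  then obtain s where "1 / a < s" "s < d" using dense by blast
  with \<open>0 < a\<close> show ?thesis by (intro that[of s]) (auto simp: real field_simps)
next
  case PInf
  with assms have "0 < a" by (simp add: zero_ereal_def)
  then show ?thesis by (intro that[of "2 / a"]) (auto simp: PInf)
qed (use assms in auto)

theorem proposition1p9:
  fixes P :: "'w::metric_space measure"
    and \<theta> :: "'w \<Rightarrow> 'w"
    and T :: "'w \<Rightarrow> 'x::metric_space \<Rightarrow> 'x"
    and \<nu> :: "('w \<times> 'x) measure"
    and \<mu> :: "'w \<Rightarrow> 'x measure"
    and C\<^sub>4 :: real
  assumes "random_dynamical_system P \<theta> T \<nu> \<mu>"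
    and "compact (UNIV :: 'x set)"
    and "bounded_local_complexity (UNIV :: 'x set)"
    and "C\<^sub>4 > 0"
  shows "AE \<omega> in P. AE (x, y) in \<mu> \<omega> \<Otimes>\<^sub>M \<mu> \<omega>.
           limsup (\<lambda>n. - elog (min_dist_le \<theta> T (gap C\<^sub>4) n \<omega> x y) / ereal (ln (real n)))
             \<le> 1 / lower_quenched_corr_dim P \<mu>"
proof -
  interpret random_dynamical_system P \<theta> T \<nu> \<mu> by fact
  let ?D = "lower_quenched_corr_dim P \<mu>"
  let ?L = "\<lambda>\<omega> x y. limsup (\<lambda>n. - elog (min_dist_le \<theta> T (gap C\<^sub>4) n \<omega> x y) / ereal (ln (real n)))"
  show ?thesis
  proof (cases "?D = 0")
    case True
    then have "1 / ?D = \<infinity>" by (simp add: divide_ereal_def)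
    then show ?thesis by (simp only:) simp
  next
    case False
    then have D: "0 < ?D" using lower_quenched_corr_dim_nonneg[OF assms(2)] by simp
    \<comment> \<open>Countably many bounds close to \<open>1 / D\<close>, so that the exceptional null sets can be merged.\<close>
    define Q where "Q = {q :: rat. 1 / ?D < ereal (of_rat q)}"
    have "AE \<omega> in P. AE (x, y) in \<mu> \<omega> \<Otimes>\<^sub>M \<mu> \<omega>. ?L \<omega> x y \<le> ereal (of_rat q)" if "q \<in> Q" for q
    proof -
      from that have "1 / ?D < ereal (of_rat q)" by (simp add: Q_def)
      with D obtain s where "ereal s < ?D" "0 < real_of_rat q" "1 < real_of_rat q * s"
        by (rule ereal_inverse_less_imp_less)
      then show ?thesis by (intro limsup_min_dist_le_AE assms)
    qed
    then have "AE \<omega> in P. \<forall>q\<in>Q. AE (x, y) in \<mu> \<omega> \<Otimes>\<^sub>M \<mu> \<omega>. ?L \<omega> x y \<le> ereal (of_rat q)"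
      by (subst AE_ball_countable) (auto simp: countable_rat)
    then have "AE \<omega> in P. AE z in \<mu> \<omega> \<Otimes>\<^sub>M \<mu> \<omega>. \<forall>q\<in>Q. ?L \<omega> (fst z) (snd z) \<le> ereal (of_rat q)"
      by (simp add: AE_ball_countable case_prod_beta')
    moreover have "?L \<omega> x y \<le> 1 / ?D" if le: "\<forall>q\<in>Q. ?L \<omega> x y \<le> ereal (of_rat q)" for \<omega> x y
    proof (rule ccontr)
      assume "\<not> ?L \<omega> x y \<le> 1 / ?D"
      then have "1 / ?D < ?L \<omega> x y" by simp
      \<comment> \<open>Two intermediate reals leave room for a rational even if the upper limit is infinite.\<close>
      then obtain t where t: "1 / ?D < ereal t" "ereal t < ?L \<omega> x y"
        by (rule ereal_dense2[THEN exE]) auto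
      then obtain t' where t': "ereal t < ereal t'" "ereal t' < ?L \<omega> x y"
        using ereal_dense2[OF t(2)] by auto
      then obtain q where q: "t < of_rat q" "of_rat q < t'"
        using of_rat_dense[of t t'] by auto
      have "q \<in> Q" using t(1) q(1) by (simp add: Q_def less_trans[OF t(1)])
      with le have "?L \<omega> x y \<le> ereal (of_rat q)" by blast
      also have "\<dots> < ereal t'" using q by simp
      finally show False using t' by simp
    qed
    ultimately show ?thesis
      by (simp add: case_prod_beta')
        (auto elim!: eventually_mono)
  qed
qed

end
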